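(* For every $\tau\in\mathbb{H}^2$, $$\frac{\theta'[\frac15,\frac95]}{\theta[\frac15,\frac95]}=\zeta_5\,\theta'[1,1]\,\frac{\theta^5[\frac15,\frac95]-3\zeta_5\,\theta^5[\frac35,\frac75]}{10\,\theta^3[\frac15,\frac95]\,\theta^3[\frac35,\frac75]},\qquad \frac{\theta'[\frac35,\frac75]}{\theta[\frac35,\frac75]}=\zeta_5\,\theta'[1,1]\,\frac{3\,\theta^5[\frac15,\frac95]+\zeta_5\,\theta^5[\frac35,\frac75]}{10\,\theta^3[\frac15,\frac95]\,\theta^3[\frac35,\frac75]}.$$
   Context: $\mathbb{H}^2=\{\tau\in\mathbb{C} : \Im\tau>0\}$ is the upper half plane and $\zeta_k=\exp(2\pi i/k)$. For $\epsilon,\epsilon'\in\mathbb{R}$, $\zeta\in\mathbb{C}$, $\tau\in\mathbb{H}^2$, the theta function with characteristics is $$\theta[\epsilon,\epsilon'](\zeta,\tau)=\sum_{n\in\mathbb{Z}}\exp\left(2\pi i\left[\tfrac12\left(n+\tfrac{\epsilon}{2}\right)^2\tau+\left(n+\tfrac{\epsilon}{2}\right)\left(\zeta+\tfrac{\epsilon'}{2}\right)\right]\right).$$ Write $\theta[\epsilon,\epsilon']=\theta[\epsilon,\epsilon'](0,\tau)$ and $\theta'[\epsilon,\epsilon']=\frac{\partial}{\partial\zeta}\theta[\epsilon,\epsilon'](\zeta,\tau)\big|_{\zeta=0}$; $\theta^k[\epsilon,\epsilon']$ means the $k$-th power of $\theta[\epsilon,\epsilon']$. *)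

theory Defs
  imports "HOL-Analysis.Analysis"
begin

definition root_unity :: "nat \<Rightarrow> complex" where
  "root_unity k = exp (2 * of_real pi * \<i> / of_nat k)"

(* The series converges absolutely when Im \<tau> > 0, so the unordered infinite sum over all
   integers is the classical value there; for other \<tau> the value carries no meaning. *)
definition theta_char :: "real \<Rightarrow> real \<Rightarrow> complex \<Rightarrow> complex \<Rightarrow> complex" where
  "theta_char \<epsilon> \<epsilon>' \<zeta> \<tau> =
     (\<Sum>\<^sub>\<infinity>n\<in>(UNIV :: int set).
        exp (2 * of_real pi * \<i> *
          (1 / 2 * (of_int n + of_real \<epsilon> / 2) ^ 2 * \<tau>
           + (of_int n + of_real \<epsilon> / 2) * (\<zeta> + of_real \<epsilon>' / 2))))"

definition theta_const :: "real \<Rightarrow> real \<Rightarrow> complex \<Rightarrow> complex" where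
  "theta_const \<epsilon> \<epsilon>' \<tau> = theta_char \<epsilon> \<epsilon>' 0 \<tau>"

definition theta_deriv :: "real \<Rightarrow> real \<Rightarrow> complex \<Rightarrow> complex" where
  "theta_deriv \<epsilon> \<epsilon>' \<tau> = deriv (\<lambda>\<zeta>. theta_char \<epsilon> \<epsilon>' \<zeta> \<tau>) 0"

end

theory Submission
  imports Defs "HOL-Complex_Analysis.Complex_Analysis"
begin

text \<open>
  Let \<open>\<vartheta>(z) = \<theta>[1,1](z,\<tau>)\<close> be the odd theta function and \<open>w = (1 - \<tau>)/5\<close>. Completing the square in
  the series shows that, for real \<open>s\<close>, the function \<open>\<theta>[1-2s, 1+2s]\<close> is a translate of \<open>\<vartheta>\<close> by
  \<open>s(1 - \<tau>)\<close> up to an exponential factor; so \<open>\<theta>[1/5,9/5]\<close> and \<open>\<theta>[3/5,7/5]\<close> are essentially the values of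
  \<open>\<vartheta>\<close> at the 5-torsion points \<open>2w\<close> and \<open>w\<close>. After multiplying \<open>\<vartheta>\<close> by the Gaussian
  \<open>exp(-\<pi>\<i> z\<^sup>2/(1 - \<tau>))\<close>, one obtains an odd entire function \<open>f\<close> (\<open>norm_theta\<close>) with \<open>f(z + 5w) = -f(z)\<close>,
  and the exponential factors become constant roots of unity, in the values and in the derivatives
  alike (\<open>theta_const_eq_norm_theta\<close>, \<open>theta_deriv_eq_norm_theta\<close>).

  The theorem then follows from one property of \<open>f\<close>, the three-term relation of Weierstrass
  (\<open>weierstrass_relation\<close>). For \<open>\<vartheta>\<close> it is the Pluecker identity for 2 by 2 minors, because
  \<open>\<vartheta>(x+y) \<vartheta>(x-y) = \<alpha>(x) \<beta>(y) - \<beta>(x) \<alpha>(y)\<close>, where \<open>\<alpha>\<close> and \<open>\<beta>\<close> are theta functions for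
  \<open>2\<tau>\<close> (\<open>theta_11_addition\<close>); the last formula is a rearrangement of a double series. Gaussian factors
  preserve the relation. Let one of its factors tend to zero: the derivative there is
  \<open>f'(0)\<close> times three values of \<open>f\<close>, expressed by a combination of four logarithmic derivatives. At multiples
  of \<open>w\<close>, oddness and the antiperiod \<open>5w\<close> collapse this to
  \<open>3 f'(w)/f(w) + f'(2w)/f(2w) = f'(0) f(2w)\<^sup>2/f(w)\<^sup>3\<close> and
  \<open>3 f'(2w)/f(2w) - f'(w)/f(w) = -f'(0) f(w)\<^sup>2/f(2w)\<^sup>3\<close>,
  the second formula being the first one for \<open>2w\<close> in place of \<open>w\<close> (\<open>five_torsion_log_deriv\<close>). These are
  two linear equations for the two logarithmic derivatives; their determinant is the 10 in the denominators.

  The divisions require \<open>\<vartheta>\<close> to be nonzero at \<open>w\<close> and \<open>2w\<close>. This too comes from the three-term relation: if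
  \<open>\<vartheta>(p) = 0\<close>, then the quotient \<open>g(z) = \<vartheta>(z+p)/\<vartheta>(z)\<close> has the property that \<open>g(s) g(t)\<close> depends on
  \<open>s + t\<close> only, so \<open>g\<close> is an exponential function, and comparison with the quasi-periods \<open>1\<close> and
  \<open>\<tau>\<close> forces \<open>p\<close> into the lattice \<open>\<int> + \<int>\<tau>\<close> (\<open>theta_11_zero_imp_lattice\<close>).
\<close>

section \<open>Convergence and holomorphy of theta series\<close>

lemma summable_exp_neg_abs_int: "(\<lambda>n::int. exp (- \<bar>real_of_int n\<bar>)) summable_on UNIV"
proof -
  have nat: "(\<lambda>n::nat. exp (- real n)) summable_on UNIV"
  proof -
    have "summable (\<lambda>n::nat. exp (-1 :: real) ^ n)"
      by (rule summable_geometric) simp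
    moreover have "exp (-1 :: real) ^ n = exp (- real n)" for n
      by (simp flip: exp_of_nat_mult)
    ultimately show ?thesis
      by (intro norm_summable_imp_summable_on) simp
  qed
  have "(\<lambda>n::int. exp (- \<bar>real_of_int n\<bar>)) summable_on range int"
    using nat by (subst summable_on_reindex) (auto simp: o_def inj_def)
  moreover have "(\<lambda>n::int. exp (- \<bar>real_of_int n\<bar>)) summable_on range (\<lambda>n. - int n)"
    using nat by (subst summable_on_reindex) (auto simp: o_def inj_def)
  ultimately have "(\<lambda>n::int. exp (- \<bar>real_of_int n\<bar>)) summable_on (range int \<union> range (\<lambda>n. - int n))"
    by (rule summable_on_union)
  moreover have "range int \<union> range (\<lambda>n. - int n) = UNIV"
    by (auto simp: image_iff) (metis int_cases2)
  ultimately show ?thesis by simp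
qed

text \<open>
  Completing the square gives \<open>-a x\<^sup>2 + b x \<le> (b + 1)\<^sup>2/(4a) - x\<close>, so the terms are dominated by a two-sided
  geometric series.
\<close>

lemma gaussian_summable_int:
  fixes a b s :: real
  assumes "a > 0"
  shows "(\<lambda>n::int. exp (- a * (of_int n + s)\<^sup>2 + b * \<bar>of_int n + s\<bar>)) summable_on UNIV"
proof (rule summable_on_comparison_test)
  define K where "K = (b + 1)\<^sup>2 / (4 * a) + \<bar>s\<bar>"
  show "(\<lambda>n::int. exp K * exp (- \<bar>real_of_int n\<bar>)) summable_on UNIV"
    by (intro summable_on_cmult_right summable_exp_neg_abs_int)
  show "exp (- a * (of_int n + s)\<^sup>2 + b * \<bar>of_int n + s\<bar>) \<le> exp K * exp (- \<bar>real_of_int n\<bar>)"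
    for n :: int
  proof -
    define x where "x = \<bar>of_int n + s\<bar>"
    have "0 \<le> (2 * a * x - (b + 1))\<^sup>2 / (4 * a)"
      using assms by simp
    also have "\<dots> = a * x\<^sup>2 - (b + 1) * x + (b + 1)\<^sup>2 / (4 * a)"
      using assms by (simp add: power2_eq_square field_simps)
    finally have "- a * x\<^sup>2 + b * x \<le> (b + 1)\<^sup>2 / (4 * a) - x"
      by (simp add: algebra_simps)
    moreover have "x\<^sup>2 = (of_int n + s)\<^sup>2" and "\<bar>real_of_int n\<bar> \<le> x + \<bar>s\<bar>"
      by (auto simp: x_def)
    ultimately have "- a * (of_int n + s)\<^sup>2 + b * x \<le> K - \<bar>real_of_int n\<bar>"
      by (simp add: K_def)
    then show ?thesis
      by (simp add: x_def flip: exp_add)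
  qed
qed simp

definition theta_term :: "real \<Rightarrow> real \<Rightarrow> complex \<Rightarrow> complex \<Rightarrow> int \<Rightarrow> complex" where
  "theta_term \<epsilon> \<epsilon>' \<zeta> \<tau> n =
     exp (2 * of_real pi * \<i> *
       (1 / 2 * (of_int n + of_real \<epsilon> / 2) ^ 2 * \<tau>
        + (of_int n + of_real \<epsilon> / 2) * (\<zeta> + of_real \<epsilon>' / 2)))"

lemma theta_char_eq_infsum: "theta_char \<epsilon> \<epsilon>' \<zeta> \<tau> = (\<Sum>\<^sub>\<infinity>n. theta_term \<epsilon> \<epsilon>' \<zeta> \<tau> n)"
  by (simp add: theta_char_def theta_term_def)

lemma norm_theta_term:
  "norm (theta_term \<epsilon> \<epsilon>' \<zeta> \<tau> n) =
     exp (- (pi * Im \<tau>) * (of_int n + \<epsilon> / 2)\<^sup>2 - 2 * pi * (of_int n + \<epsilon> / 2) * Im \<zeta>)"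
proof -
  have "of_int n + of_real \<epsilon> / 2 = (of_real (of_int n + \<epsilon> / 2) :: complex)"
    by simp
  then show ?thesis
    unfolding theta_term_def by (simp only: norm_exp_eq_Re) (simp add: algebra_simps flip: of_real_power)
qed

lemma norm_theta_term_le:
  assumes "\<bar>Im \<zeta>\<bar> \<le> R"
  shows "norm (theta_term \<epsilon> \<epsilon>' \<zeta> \<tau> n) \<le>
    exp (- (pi * Im \<tau>) * (of_int n + \<epsilon> / 2)\<^sup>2 + 2 * pi * R * \<bar>of_int n + \<epsilon> / 2\<bar>)"
proof -
  have "- ((of_int n + \<epsilon> / 2) * Im \<zeta>) \<le> \<bar>of_int n + \<epsilon> / 2\<bar> * \<bar>Im \<zeta>\<bar>"
    by (metis abs_ge_minus_self abs_mult)
  also have "\<dots> \<le> \<bar>of_int n + \<epsilon> / 2\<bar> * R"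
    by (intro mult_left_mono assms) simp
  finally have "2 * pi * (- ((of_int n + \<epsilon> / 2) * Im \<zeta>)) \<le> 2 * pi * (\<bar>of_int n + \<epsilon> / 2\<bar> * R)"
    by (intro mult_left_mono) simp_all
  then show ?thesis
    unfolding norm_theta_term by (simp add: algebra_simps)
qed

lemma abs_summable_theta_term:
  assumes "Im \<tau> > 0"
  shows "(\<lambda>n. norm (theta_term \<epsilon> \<epsilon>' \<zeta> \<tau> n)) summable_on UNIV"
proof (rule summable_on_comparison_test)
  show "(\<lambda>n. exp (- (pi * Im \<tau>) * (of_int n + \<epsilon> / 2)\<^sup>2 + 2 * pi * \<bar>Im \<zeta>\<bar> * \<bar>of_int n + \<epsilon> / 2\<bar>))
    summable_on UNIV"
    by (rule gaussian_summable_int) (use assms in simp)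
qed (use norm_theta_term_le[of \<zeta> "\<bar>Im \<zeta>\<bar>"] in simp_all)

text \<open>
  On a bounded set of \<open>\<zeta>\<close> the imaginary part is bounded, and then one Gaussian series majorises all
  the theta series at once.
\<close>

lemma uniform_limit_theta_char:
  assumes "Im \<tau> > 0" and "bounded S"
  shows "uniform_limit S (\<lambda>N \<zeta>. \<Sum>n\<in>N. theta_term \<epsilon> \<epsilon>' \<zeta> \<tau> n)
    (\<lambda>\<zeta>. theta_char \<epsilon> \<epsilon>' \<zeta> \<tau>) (finite_subsets_at_top UNIV)"
proof -
  obtain R where "\<And>\<zeta>. \<zeta> \<in> S \<Longrightarrow> norm \<zeta> \<le> R"
    using assms(2) unfolding bounded_iff by blast
  then have R: "\<bar>Im \<zeta>\<bar> \<le> R" if "\<zeta> \<in> S" for \<zeta>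
    using that abs_Im_le_cmod order_trans by blast
  show ?thesis
    unfolding theta_char_eq_infsum
    by (rule Weierstrass_m_test_general[OF norm_theta_term_le[OF R] gaussian_summable_int])
       (use assms in simp_all)
qed

lemma theta_term_holomorphic: "(\<lambda>\<zeta>. theta_term \<epsilon> \<epsilon>' \<zeta> \<tau> n) holomorphic_on S"
  unfolding theta_term_def by (intro holomorphic_intros)

lemma theta_char_holomorphic:
  assumes "Im \<tau> > 0"
  shows "(\<lambda>\<zeta>. theta_char \<epsilon> \<epsilon>' \<zeta> \<tau>) holomorphic_on S"
proof -
  have "(\<lambda>\<zeta>. theta_char \<epsilon> \<epsilon>' \<zeta> \<tau>) holomorphic_on ball 0 r" for r
  proof (rule holomorphic_uniform_limit)
    show "uniform_limit (cball 0 r) (\<lambda>N \<zeta>. \<Sum>n\<in>N. theta_term \<epsilon> \<epsilon>' \<zeta> \<tau> n)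
      (\<lambda>\<zeta>. theta_char \<epsilon> \<epsilon>' \<zeta> \<tau>) (finite_subsets_at_top UNIV)"
      using assms by (rule uniform_limit_theta_char) simp
    show "\<forall>\<^sub>F N in finite_subsets_at_top UNIV.
        continuous_on (cball 0 r) (\<lambda>\<zeta>. \<Sum>n\<in>N. theta_term \<epsilon> \<epsilon>' \<zeta> \<tau> n) \<and>
        (\<lambda>\<zeta>. \<Sum>n\<in>N. theta_term \<epsilon> \<epsilon>' \<zeta> \<tau> n) holomorphic_on ball 0 r"
      by (intro always_eventually allI conjI holomorphic_on_imp_continuous_on
          holomorphic_on_sum theta_term_holomorphic)
  qed auto
  moreover have "\<zeta> \<in> ball 0 (norm \<zeta> + 1)" for \<zeta> :: complex
    by simp
  ultimately have "(\<lambda>\<zeta>. theta_char \<epsilon> \<epsilon>' \<zeta> \<tau>) field_differentiable at \<zeta>" for \<zeta>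
    by (metis holomorphic_on_imp_differentiable_at open_ball)
  then show ?thesis
    using field_differentiable_at_within unfolding holomorphic_on_def by blast
qed

section \<open>Characteristics, parity and quasi-periods\<close>

text \<open>
  Both sides agree term by term: moving \<open>a\<close> from the summation index into the argument is completing
  the square in the exponent.
\<close>

lemma theta_char_characteristic_shift:
  "theta_char (\<epsilon> + 2 * a) (\<epsilon>' + 2 * b) \<zeta> \<tau> =
     exp (2 * of_real pi * \<i> * (1 / 2 * of_real a ^ 2 * \<tau> + of_real a * (\<zeta> + of_real \<epsilon>' / 2 + of_real b)))
     * theta_char \<epsilon> \<epsilon>' (\<zeta> + of_real a * \<tau> + of_real b) \<tau>"
proof -
  have "theta_term (\<epsilon> + 2 * a) (\<epsilon>' + 2 * b) \<zeta> \<tau> n =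
     exp (2 * of_real pi * \<i> * (1 / 2 * of_real a ^ 2 * \<tau> + of_real a * (\<zeta> + of_real \<epsilon>' / 2 + of_real b)))
     * theta_term \<epsilon> \<epsilon>' (\<zeta> + of_real a * \<tau> + of_real b) \<tau> n" for n
    unfolding theta_term_def exp_add[symmetric]
    by (rule arg_cong[where f = exp]) (simp add: power2_eq_square field_simps)
  then show ?thesis
    unfolding theta_char_eq_infsum infsum_cmult_right'[symmetric] by (intro infsum_cong)
qed

lemma theta_char_add_2_left: "theta_char (\<epsilon> + 2) \<epsilon>' \<zeta> \<tau> = theta_char \<epsilon> \<epsilon>' \<zeta> \<tau>"
  unfolding theta_char_eq_infsum
  by (rule infsum_reindex_bij_witness[where i = "\<lambda>n. n - 1" and j = "\<lambda>n. n + 1"])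
     (auto simp: theta_term_def add_divide_distrib add_ac)

lemma exp_2pi_i_int: "exp (2 * of_real pi * \<i> * of_int n) = 1"
  using exp_integer_2pi[of "of_int n"] by (simp add: mult_ac)

lemma theta_char_add_2_right:
  "theta_char \<epsilon> (\<epsilon>' + 2) \<zeta> \<tau> = exp (of_real pi * \<i> * of_real \<epsilon>) * theta_char \<epsilon> \<epsilon>' \<zeta> \<tau>"
proof -
  have "theta_term \<epsilon> (\<epsilon>' + 2) \<zeta> \<tau> n = exp (of_real pi * \<i> * of_real \<epsilon>) * theta_term \<epsilon> \<epsilon>' \<zeta> \<tau> n" for n
  proof -
    have "theta_term \<epsilon> (\<epsilon>' + 2) \<zeta> \<tau> n =
      exp (2 * of_real pi * \<i> * of_int n) * exp (of_real pi * \<i> * of_real \<epsilon>) * theta_term \<epsilon> \<epsilon>' \<zeta> \<tau> n"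
      unfolding theta_term_def exp_add[symmetric]
      by (rule arg_cong[where f = exp]) (simp add: power2_eq_square field_simps)
    then show ?thesis by (simp add: exp_2pi_i_int)
  qed
  then show ?thesis
    unfolding theta_char_eq_infsum infsum_cmult_right'[symmetric] by (intro infsum_cong)
qed

lemma theta_char_minus: "theta_char (- \<epsilon>) (- \<epsilon>') (- \<zeta>) \<tau> = theta_char \<epsilon> \<epsilon>' \<zeta> \<tau>"
  unfolding theta_char_eq_infsum
proof (rule infsum_reindex_bij_witness[where i = uminus and j = uminus])
  show "theta_term \<epsilon> \<epsilon>' \<zeta> \<tau> (- n) = theta_term (- \<epsilon>) (- \<epsilon>') (- \<zeta>) \<tau> n" for n
    unfolding theta_term_def
    by (rule arg_cong[where f = exp]) (simp add: power2_eq_square algebra_simps)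
qed auto

text \<open>
  Negation turns the characteristic \<open>[1,1]\<close> into \<open>[-1,-1]\<close>; returning to \<open>[1,1]\<close> costs
  the factor \<open>exp(\<pi>\<i>) = -1\<close>.
\<close>

lemma theta_11_minus: "theta_char 1 1 (- z) \<tau> = - theta_char 1 1 z \<tau>"
  using theta_char_minus[of 1 1 z \<tau>] theta_char_add_2_left[of "-1" "-1" "-z" \<tau>]
    theta_char_add_2_right[of 1 "-1" "-z" \<tau>]
  by simp

lemma theta_11_add_1: "theta_char 1 1 (z + 1) \<tau> = - theta_char 1 1 z \<tau>"
  using theta_char_characteristic_shift[of 1 0 1 1 z \<tau>] theta_char_add_2_right[of 1 1 z \<tau>]
  by simp

lemma theta_11_add_tau:
  "theta_char 1 1 (z + \<tau>) \<tau> = - exp (- of_real pi * \<i> * (\<tau> + 2 * z)) * theta_char 1 1 z \<tau>"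
proof -
  define E where "E = exp (of_real pi * \<i> * (\<tau> + 2 * z))"
  have "exp (2 * of_real pi * \<i> * (\<tau> / 2 + (z + 1 / 2))) = E * exp (of_real pi * \<i>)"
    unfolding E_def exp_add[symmetric]
    by (rule arg_cong[where f = exp]) (simp add: field_simps)
  then have "theta_char 1 1 z \<tau> = - E * theta_char 1 1 (z + \<tau>) \<tau>"
    using theta_char_characteristic_shift[of 1 1 1 0 z \<tau>] theta_char_add_2_left[of 1 1 z \<tau>]
    by simp
  moreover have "exp (- of_real pi * \<i> * (\<tau> + 2 * z)) * E = 1"
    unfolding E_def exp_add[symmetric] by simp
  ultimately show ?thesis
    by (simp add: mult.assoc[symmetric])
qed

section \<open>Theta series do not vanish identically\<close>

lemma has_integral_exp_2pi_i_int:
  "((\<lambda>t. exp (2 * of_real pi * \<i> * of_int n * of_real t)) has_integral (if n = 0 then 1 else 0)) {0..1::real}"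
proof (cases "n = 0")
  case True
  then show ?thesis
    using has_integral_const_real[of "1::complex" 0 1] by simp
next
  case False
  define c where "c = 2 * of_real pi * \<i> * of_int n"
  have "c \<noteq> 0" using False by (simp add: c_def)
  have "((\<lambda>t. exp (c * of_real t) / c) has_vector_derivative exp (c * of_real t)) (at t within {0..1})" for t :: real
  proof -
    have "((\<lambda>z. exp (c * z) / c) has_field_derivative exp (c * of_real t)) (at (of_real t))"
      using \<open>c \<noteq> 0\<close> by (auto intro!: derivative_eq_intros)
    then show ?thesis
      using has_vector_derivative_real_field by blast
  qed
  then have "((\<lambda>t. exp (c * of_real t)) has_integral
      (exp (c * of_real 1) / c - exp (c * of_real 0) / c)) {0..1::real}"
    by (intro fundamental_theorem_of_calculus) auto
  moreover have "exp c = 1"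
    unfolding c_def by (rule exp_2pi_i_int)
  ultimately show ?thesis
    using False by (simp add: c_def)
qed

text \<open>
  On the real line, after removing the factor \<open>exp(\<pi>\<i>\<epsilon>t)\<close>, the theta series is a uniformly convergent Fourier
  series. Integration over a period recovers its coefficient of index 0, which is an exponential and
  hence nonzero.
\<close>

lemma theta_char_not_identically_zero:
  assumes "Im \<tau> > 0"
  obtains \<zeta> where "theta_char \<epsilon> \<epsilon>' \<zeta> \<tau> \<noteq> 0"
proof -
  define E where "E = (\<lambda>t::real. exp (- (2 * of_real pi * \<i> * of_real (\<epsilon> / 2) * of_real t)))"
  define T where "T = (\<lambda>n t. theta_term \<epsilon> \<epsilon>' (of_real t) \<tau> n * E t)"
  have T: "T n t = theta_term \<epsilon> \<epsilon>' 0 \<tau> n * exp (2 * of_real pi * \<i> * of_int n * of_real t)" for n t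
    unfolding T_def E_def theta_term_def exp_add[symmetric]
    by (rule arg_cong[where f = exp]) (simp add: field_simps)
  have intT: "(T n has_integral (if n = 0 then theta_term \<epsilon> \<epsilon>' 0 \<tau> 0 else 0)) {0..1}" for n
    using has_integral_mult_right[OF has_integral_exp_2pi_i_int[of n], of "theta_term \<epsilon> \<epsilon>' 0 \<tau> n"]
    unfolding T by (auto split: if_splits)
  have False if zero: "\<And>\<zeta>. theta_char \<epsilon> \<epsilon>' \<zeta> \<tau> = 0"
  proof -
    have "uniform_limit (of_real ` {0..1::real}) (\<lambda>N \<zeta>. \<Sum>n\<in>N. theta_term \<epsilon> \<epsilon>' \<zeta> \<tau> n)
        (\<lambda>\<zeta>. theta_char \<epsilon> \<epsilon>' \<zeta> \<tau>) (finite_subsets_at_top UNIV)"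
      using assms by (intro uniform_limit_theta_char compact_imp_bounded compact_continuous_image
          continuous_intros) auto
    then have "uniform_limit {0..1} (\<lambda>N t. \<Sum>n\<in>N. theta_term \<epsilon> \<epsilon>' (of_real t) \<tau> n)
        (\<lambda>t. 0) (finite_subsets_at_top UNIV)"
      unfolding zero by (rule uniform_limit_compose') auto
    then have "uniform_limit {0..1} (\<lambda>N t. (\<Sum>n\<in>N. theta_term \<epsilon> \<epsilon>' (of_real t) \<tau> n) * E t)
        (\<lambda>t. 0 * E t) (finite_subsets_at_top UNIV)"
    proof (rule uniform_lim_mult)
      show "bounded (E ` {0..1})"
        unfolding E_def by (intro compact_imp_bounded compact_continuous_image continuous_intros) auto
    qed (auto intro: uniform_limit_const simp: image_constant_conv)
    then have "uniform_limit {0..1} (\<lambda>N t. \<Sum>n\<in>N. T n t) (\<lambda>t. 0) (finite_subsets_at_top UNIV)"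
      by (simp add: T_def sum_distrib_right)
    then obtain I J where IJ: "\<And>N. ((\<lambda>t. \<Sum>n\<in>N. T n t) has_integral I N) {0..1}"
        "((\<lambda>t. 0) has_integral J) {0..1::real}" "(I \<longlongrightarrow> J) (finite_subsets_at_top UNIV)"
      by (rule uniform_limit_integral) (auto simp: T intro!: continuous_intros)
    have "I N = theta_term \<epsilon> \<epsilon>' 0 \<tau> 0" if "finite N" "0 \<in> N" for N
    proof -
      have "((\<lambda>t. \<Sum>n\<in>N. T n t) has_integral
          (\<Sum>n\<in>N. if n = 0 then theta_term \<epsilon> \<epsilon>' 0 \<tau> 0 else 0)) {0..1}"
        by (rule has_integral_sum[OF that(1) intT])
      then show ?thesis
        using IJ(1)[of N] that by (simp add: has_integral_unique)
    qed
    then have "\<forall>\<^sub>F N in finite_subsets_at_top UNIV. I N = theta_term \<epsilon> \<epsilon>' 0 \<tau> 0"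
      unfolding eventually_finite_subsets_at_top by (intro exI[of _ "{0}"]) auto
    then have "(I \<longlongrightarrow> theta_term \<epsilon> \<epsilon>' 0 \<tau> 0) (finite_subsets_at_top UNIV)"
      by (rule tendsto_eventually)
    then have "J = theta_term \<epsilon> \<epsilon>' 0 \<tau> 0"
      using IJ(3) tendsto_unique finite_subsets_at_top_neq_bot by blast
    moreover have "J = 0"
      using IJ(2) has_integral_0 has_integral_unique by blast
    ultimately show False
      by (simp add: theta_term_def)
  qed
  then show thesis using that by blast
qed

section \<open>The addition formula and the Weierstrass relation\<close>

lemma infsum_prod_abs_summable:
  fixes f :: "'a \<Rightarrow> complex" and g :: "'b \<Rightarrow> complex"
  assumes "(\<lambda>i. norm (f i)) summable_on A" and "(\<lambda>j. norm (g j)) summable_on B"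
  shows "(\<lambda>(i, j). f i * g j) summable_on A \<times> B"
    and "infsum f A * infsum g B = (\<Sum>\<^sub>\<infinity>(i, j)\<in>A \<times> B. f i * g j)"
proof -
  have "(\<lambda>p. norm (case p of (i, j) \<Rightarrow> f i * g j)) summable_on A \<times> B"
  proof -
    have "(\<lambda>(i, j). norm (f i) * norm (g j)) summable_on A \<times> B"
    proof (rule summable_on_SigmaI[where g = "\<lambda>i. norm (f i) * infsum (\<lambda>j. norm (g j)) B"])
      show "((\<lambda>j. case (i, j) of (i, j) \<Rightarrow> norm (f i) * norm (g j)) has_sum
          norm (f i) * infsum (\<lambda>j. norm (g j)) B) B" for i
        by (simp add: has_sum_cmult_right assms(2))
      show "(\<lambda>i. norm (f i) * infsum (\<lambda>j. norm (g j)) B) summable_on A"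
        by (intro summable_on_cmult_left assms(1))
    qed auto
    then show ?thesis
      by (simp add: case_prod_unfold norm_mult)
  qed
  then show *: "(\<lambda>(i, j). f i * g j) summable_on A \<times> B"
    by (rule abs_summable_summable)
  show "infsum f A * infsum g B = (\<Sum>\<^sub>\<infinity>(i, j)\<in>A \<times> B. f i * g j)"
    using infsum_Sigma_banach[OF *] by (simp add: infsum_cmult_right' infsum_cmult_left')
qed

text \<open>
  In the double series over \<open>(m, n)\<close> the quadratic form \<open>(m + 1/2)\<^sup>2 + (n + 1/2)\<^sup>2\<close> becomes
  \<open>(M\<^sup>2 + N\<^sup>2)/2\<close> for \<open>M = m + n + 1\<close> and \<open>N = m - n\<close>, and the linear form becomes \<open>M x + N y\<close>. The two
  integers \<open>M\<close> and \<open>N\<close> have opposite parity. If \<open>m + n\<close> is odd, then \<open>M = 2k\<close> and \<open>N = 2l + 1\<close>; if it is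
  even, then \<open>M = 2k + 1\<close> and \<open>N = 2l\<close>. In either case the double series splits into a product of theta series for
  \<open>2\<tau>\<close>; the minus sign is the value \<open>exp(\<pi>\<i>M)\<close> for odd \<open>M\<close>.
\<close>

lemma theta_11_addition:
  assumes "Im \<tau> > 0"
  shows "theta_char 1 1 (x + y) \<tau> * theta_char 1 1 (x - y) \<tau> =
    theta_char 0 0 (2 * x) (2 * \<tau>) * theta_char 1 0 (2 * y) (2 * \<tau>)
    - theta_char 1 0 (2 * x) (2 * \<tau>) * theta_char 0 0 (2 * y) (2 * \<tau>)"
proof -
  let ?T = "\<lambda>(m, n). theta_term 1 1 (x + y) \<tau> m * theta_term 1 1 (x - y) \<tau> n"
  define Ev Od :: "(int \<times> int) set" where "Ev = {(m, n). even (m + n)}" and "Od = {(m, n). odd (m + n)}"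
  have tau2: "Im (2 * \<tau>) > 0" using assms by simp
  note sm = abs_summable_theta_term[OF assms] abs_summable_theta_term[OF tau2]
  have T: "?T summable_on UNIV"
    using infsum_prod_abs_summable(1)[OF sm(1) sm(1)] by simp
  have exp_odd: "exp (of_real pi * \<i> * of_int (2 * k + 1)) = -1" for k
  proof -
    have "exp (of_real pi * \<i> * of_int (2 * k + 1)) = exp (2 * of_real pi * \<i> * of_int k) * exp (of_real pi * \<i>)"
      unfolding exp_add[symmetric] by (rule arg_cong[where f = exp]) (simp add: algebra_simps)
    then show ?thesis by (simp add: exp_2pi_i_int)
  qed
  have even_term: "?T (k + l, k - l) =
      - (theta_term 1 0 (2 * x) (2 * \<tau>) k * theta_term 0 0 (2 * y) (2 * \<tau>) l)" for k l
  proof -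
    have "?T (k + l, k - l) = exp (of_real pi * \<i> * of_int (2 * k + 1)) *
        (theta_term 1 0 (2 * x) (2 * \<tau>) k * theta_term 0 0 (2 * y) (2 * \<tau>) l)"
      unfolding theta_term_def prod.case exp_add[symmetric]
      by (rule arg_cong[where f = exp]) (simp add: power2_eq_square field_simps)
    then show ?thesis by (simp add: exp_odd del: of_int_add of_int_mult)
  qed
  have odd_term: "?T (k + l, k - l - 1) =
      theta_term 0 0 (2 * x) (2 * \<tau>) k * theta_term 1 0 (2 * y) (2 * \<tau>) l" for k l
  proof -
    have "?T (k + l, k - l - 1) = exp (2 * of_real pi * \<i> * of_int k) *
        (theta_term 0 0 (2 * x) (2 * \<tau>) k * theta_term 1 0 (2 * y) (2 * \<tau>) l)"
      unfolding theta_term_def prod.case exp_add[symmetric]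
      by (rule arg_cong[where f = exp]) (simp add: power2_eq_square field_simps)
    then show ?thesis by (simp add: exp_2pi_i_int)
  qed
  have Ev: "Ev = range (\<lambda>(k, l). (k + l, k - l))"
  proof (intro set_eqI iffI)
    fix p assume "p \<in> Ev"
    then obtain m n where p: "p = (m, n)" "even (m - n)"
      by (auto simp: Ev_def)
    then obtain l where "m - n = 2 * l" by blast
    then have "p = (\<lambda>(k, l). (k + l, k - l)) (n + l, l)"
      using p by simp
    then show "p \<in> range (\<lambda>(k, l). (k + l, k - l))" by blast
  qed (auto simp: Ev_def)
  have Od: "Od = range (\<lambda>(k, l). (k + l, k - l - 1))"
  proof (intro set_eqI iffI)
    fix p assume "p \<in> Od"
    then obtain m n where p: "p = (m, n)" "odd (m - n)"
      by (auto simp: Od_def)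
    then obtain l where "m - n = 2 * l + 1" using oddE by blast
    then have "p = (\<lambda>(k, l). (k + l, k - l - 1)) (n + l + 1, l)"
      using p by simp
    then show "p \<in> range (\<lambda>(k, l). (k + l, k - l - 1))" by blast
  qed (auto simp: Od_def)
  have even_sum: "infsum ?T Ev = - (theta_char 1 0 (2 * x) (2 * \<tau>) * theta_char 0 0 (2 * y) (2 * \<tau>))"
  proof -
    have "infsum ?T Ev = (\<Sum>\<^sub>\<infinity>(k, l)\<in>UNIV. - (theta_term 1 0 (2 * x) (2 * \<tau>) k * theta_term 0 0 (2 * y) (2 * \<tau>) l))"
      by (subst Ev, subst infsum_reindex) (auto simp: inj_on_def o_def case_prod_unfold even_term[unfolded prod.case])
    also have "\<dots> = - (theta_char 1 0 (2 * x) (2 * \<tau>) * theta_char 0 0 (2 * y) (2 * \<tau>))"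
      unfolding theta_char_eq_infsum infsum_prod_abs_summable(2)[OF sm(2) sm(2)]
      by (simp add: case_prod_unfold infsum_uminus)
    finally show ?thesis .
  qed
  have odd_sum: "infsum ?T Od = theta_char 0 0 (2 * x) (2 * \<tau>) * theta_char 1 0 (2 * y) (2 * \<tau>)"
  proof -
    have "infsum ?T Od = (\<Sum>\<^sub>\<infinity>(k, l)\<in>UNIV. theta_term 0 0 (2 * x) (2 * \<tau>) k * theta_term 1 0 (2 * y) (2 * \<tau>) l)"
      by (subst Od, subst infsum_reindex) (auto simp: inj_on_def o_def case_prod_unfold odd_term[unfolded prod.case])
    also have "\<dots> = theta_char 0 0 (2 * x) (2 * \<tau>) * theta_char 1 0 (2 * y) (2 * \<tau>)"
      unfolding theta_char_eq_infsum infsum_prod_abs_summable(2)[OF sm(2) sm(2)] by simp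
    finally show ?thesis .
  qed
  have "theta_char 1 1 (x + y) \<tau> * theta_char 1 1 (x - y) \<tau> = infsum ?T UNIV"
    unfolding theta_char_eq_infsum infsum_prod_abs_summable(2)[OF sm(1) sm(1)] by simp
  also have "UNIV = Ev \<union> Od"
    by (auto simp: Ev_def Od_def)
  also have "infsum ?T (Ev \<union> Od) = infsum ?T Ev + infsum ?T Od"
    by (rule infsum_Un_disjoint) (auto simp: Ev_def Od_def intro: summable_on_subset_banach[OF T])
  finally show ?thesis
    by (simp add: even_sum odd_sum)
qed

text \<open>
  This is the three-term relation of the Weierstrass \<open>\<sigma>\<close>-function.
\<close>

definition weierstrass_relation :: "(complex \<Rightarrow> complex) \<Rightarrow> bool" where
  "weierstrass_relation f \<longleftrightarrow> (\<forall>x y u v.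
     (f (x + y) * f (x - y)) * (f (u + v) * f (u - v)) =
     (f (x + u) * f (x - u)) * (f (y + v) * f (y - v))
     - (f (x + v) * f (x - v)) * (f (y + u) * f (y - u)))"

text \<open>
  By the addition formula \<open>\<vartheta>(x+y) \<vartheta>(x-y)\<close> is the 2 by 2 minor of the vectors
  \<open>(\<alpha>(x), \<beta>(x))\<close> and \<open>(\<alpha>(y), \<beta>(y))\<close>, and the relation is the Pluecker identity for four
  vectors in the plane.
\<close>

lemma weierstrass_relation_theta_11:
  assumes "Im \<tau> > 0"
  shows "weierstrass_relation (\<lambda>z. theta_char 1 1 z \<tau>)"
  unfolding weierstrass_relation_def theta_11_addition[OF assms] by (simp add: algebra_simps)

text \<open>
  In each of the three terms the Gaussian contributes the same factor
  \<open>exp(2c(x\<^sup>2 + y\<^sup>2 + u\<^sup>2 + v\<^sup>2))\<close>.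
\<close>

lemma weierstrass_relation_gaussian:
  assumes "weierstrass_relation f"
  shows "weierstrass_relation (\<lambda>z. exp (c * z\<^sup>2) * f z)"
  unfolding weierstrass_relation_def
proof (intro allI)
  fix x y u v :: complex
  let ?g = "\<lambda>z. exp (c * z\<^sup>2) * f z"
  have E: "(?g (x + y) * ?g (x - y)) * (?g (u + v) * ?g (u - v)) =
    exp (2 * c * (x\<^sup>2 + y\<^sup>2 + u\<^sup>2 + v\<^sup>2)) * ((f (x + y) * f (x - y)) * (f (u + v) * f (u - v)))" for x y u v
  proof -
    have "exp (2 * c * (x\<^sup>2 + y\<^sup>2 + u\<^sup>2 + v\<^sup>2)) =
      exp (c * (x + y)\<^sup>2) * exp (c * (x - y)\<^sup>2) * (exp (c * (u + v)\<^sup>2) * exp (c * (u - v)\<^sup>2))"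
      unfolding exp_add[symmetric]
      by (rule arg_cong[where f = exp]) (simp add: power2_eq_square algebra_simps)
    then show ?thesis by (simp add: mult_ac)
  qed
  have "(f (x + y) * f (x - y)) * (f (u + v) * f (u - v)) =
     (f (x + u) * f (x - u)) * (f (y + v) * f (y - v))
     - (f (x + v) * f (x - v)) * (f (y + u) * f (y - u))"
    using assms unfolding weierstrass_relation_def by blast
  moreover have "x\<^sup>2 + u\<^sup>2 + y\<^sup>2 + v\<^sup>2 = x\<^sup>2 + y\<^sup>2 + u\<^sup>2 + v\<^sup>2" "x\<^sup>2 + v\<^sup>2 + y\<^sup>2 + u\<^sup>2 = x\<^sup>2 + y\<^sup>2 + u\<^sup>2 + v\<^sup>2"
    by simp_all
  ultimately show "(?g (x + y) * ?g (x - y)) * (?g (u + v) * ?g (u - v)) =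
     (?g (x + u) * ?g (x - u)) * (?g (y + v) * ?g (y - v))
     - (?g (x + v) * ?g (x - v)) * (?g (y + u) * ?g (y - u))"
    unfolding E by (simp only: right_diff_distrib)
qed

section \<open>Zeros\<close>

text \<open>
  For \<open>x = y + p\<close> the first product of the three-term relation contains \<open>f p = 0\<close>, so that only two
  products remain. For \<open>g(z) = f(z + p)/f(z)\<close> the result says that \<open>g(s) g(t)\<close> depends on \<open>s + t\<close> only.
\<close>

lemma weierstrass_relation_shift:
  assumes "weierstrass_relation f" and "f p = 0"
  shows "f (s + d + p) * f (t - d + p) * (f s * f t) = f (s + p) * f (t + p) * (f (s + d) * f (t - d))"
proof -
  \<comment> \<open>The midpoint substitution: \<open>s\<close> and \<open>t\<close> become \<open>y \<plusminus> v\<close>, while \<open>s + d\<close> and \<open>t - d\<close> become \<open>y \<plusminus> u\<close>.\<close>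
  define y u v where "y = (s + t) / 2" and "u = (s - t) / 2 + d" and "v = (s - t) / 2"
  have *: "s + d + p = y + p + u" "t - d + p = y + p - u" "s = y + v" "t = y - v"
    "s + p = y + p + v" "t + p = y + p - v" "s + d = y + u" "t - d = y - u"
    by (simp_all add: y_def u_def v_def field_simps)
  have "(f (y + p + y) * f (y + p - y)) * (f (u + v) * f (u - v)) =
     (f (y + p + u) * f (y + p - u)) * (f (y + v) * f (y - v))
     - (f (y + p + v) * f (y + p - v)) * (f (y + u) * f (y - u))"
    using assms(1) unfolding weierstrass_relation_def by blast
  moreover have "f (y + p - y) = 0"
    using assms(2) by simp
  ultimately have "(f (y + p + u) * f (y + p - u)) * (f (y + v) * f (y - v)) =
     (f (y + p + v) * f (y + p - v)) * (f (y + u) * f (y - u))"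
    by simp
  then show ?thesis
    using * by metis
qed

lemma entire_deriv:
  assumes "f holomorphic_on UNIV"
  shows "(f has_field_derivative deriv f z) (at z)"
  using assms by (rule holomorphic_derivI) auto

lemma entire_deriv_translate:
  assumes "f holomorphic_on UNIV"
  shows "((\<lambda>d. f (s + d)) has_field_derivative deriv f s) (at 0)"
proof -
  have "((\<lambda>d. s + d) has_field_derivative 1) (at 0)"
    by (auto intro!: derivative_eq_intros)
  from DERIV_chain2[OF entire_deriv[OF assms] this] show ?thesis by simp
qed

lemma entire_deriv_reflect:
  assumes "f holomorphic_on UNIV"
  shows "((\<lambda>d. f (t - d)) has_field_derivative - deriv f t) (at 0)"
proof -
  have "((\<lambda>d. t - d) has_field_derivative -1) (at 0)"
    by (auto intro!: derivative_eq_intros)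
  from DERIV_chain2[OF entire_deriv[OF assms] this] show ?thesis by simp
qed

text \<open>
  An entire function that vanishes on the nonempty open set where \<open>f \<noteq> 0\<close> is zero.
\<close>

lemma entire_common_nonzero:
  assumes "f holomorphic_on UNIV" "g holomorphic_on UNIV" "f a \<noteq> 0" "g b \<noteq> 0"
  obtains t r where "g t \<noteq> 0" "r > 0" "\<And>z. z \<in> ball t r \<Longrightarrow> f z \<noteq> 0"
proof -
  define S where "S = {z. f z \<noteq> 0}"
  have "open S"
    unfolding S_def using assms(1)
    by (intro open_Collect_neq continuous_intros holomorphic_on_imp_continuous_on)
  moreover have "\<exists>t\<in>S. g t \<noteq> 0"
  proof (rule ccontr)
    assume "\<not> (\<exists>t\<in>S. g t \<noteq> 0)"
    then have "g b = 0"
      using assms(3) \<open>open S\<close>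
      by (intro analytic_continuation_open[of S UNIV g "\<lambda>_. 0" b] assms(2) holomorphic_on_const)
         (auto simp: S_def)
    with assms(4) show False by simp
  qed
  ultimately obtain t r where "t \<in> S" "g t \<noteq> 0" "r > 0" "ball t r \<subseteq> S"
    unfolding open_contains_ball by blast
  then show thesis
    by (intro that[of t r]) (auto simp: S_def)
qed

text \<open>
  With \<open>g(z) = f(z + p)\<close>, differentiating the shift identity in \<open>d\<close> at 0 gives
  \<open>g'/g - f'/f\<close> the same value \<open>c\<close> at \<open>s\<close> and at \<open>t\<close>. Cleared of denominators, for one fixed \<open>t\<close>, this is a
  linear differential equation which says that \<open>g(z) exp(-cz)/f(z)\<close> is locally constant.
\<close>

lemma weierstrass_zero_imp_quasi_period:
  assumes W: "weierstrass_relation f" and hol: "f holomorphic_on UNIV"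
    and "f a \<noteq> 0" and "f p = 0"
  shows "\<exists>c K. K \<noteq> 0 \<and> (\<forall>z. f (z + p) = K * exp (c * z) * f z)"
proof -
  define g where "g = (\<lambda>z. f (z + p))"
  have holg: "g holomorphic_on UNIV"
  proof -
    have "f \<circ> (\<lambda>z. z + p) holomorphic_on UNIV"
      by (rule holomorphic_on_compose_gen[OF _ hol]) (auto intro: holomorphic_intros)
    then show ?thesis by (simp add: g_def o_def)
  qed
  note df = entire_deriv[OF hol] and dg = entire_deriv[OF holg]
  have "g (a - p) \<noteq> 0" using assms(3) by (simp add: g_def)
  then obtain t r where t: "g t \<noteq> 0" "r > 0" and nz: "\<And>z. z \<in> ball t r \<Longrightarrow> f z \<noteq> 0"
    using entire_common_nonzero[OF hol holg assms(3)] by blast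
  then have "f t \<noteq> 0" by simp
  define c where "c = deriv g t / g t - deriv f t / f t"
  have ode: "deriv g s * f s - g s * deriv f s = c * (g s * f s)" for s
  proof -
    have eq: "(\<lambda>d. g (s + d) * g (t - d) * (f s * f t)) = (\<lambda>d. g s * g t * (f (s + d) * f (t - d)))"
      using weierstrass_relation_shift[OF W assms(4)] by (simp add: g_def fun_eq_iff)
    have "((\<lambda>d. g (s + d) * g (t - d) * (f s * f t)) has_field_derivative
        (deriv g s * g t - g s * deriv g t) * (f s * f t)) (at 0)"
      using DERIV_cmult_right[OF DERIV_mult[OF entire_deriv_translate[OF holg, of s] entire_deriv_reflect[OF holg, of t]],
          of "f s * f t"]
      by (simp add: mult.commute)
    moreover have "((\<lambda>d. g s * g t * (f (s + d) * f (t - d))) has_field_derivative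
        g s * g t * (deriv f s * f t - f s * deriv f t)) (at 0)"
      using DERIV_cmult[OF DERIV_mult[OF entire_deriv_translate[OF hol, of s] entire_deriv_reflect[OF hol, of t]],
          of "g s * g t"]
      by (simp add: mult.commute)
    ultimately have "(deriv g s * g t - g s * deriv g t) * (f s * f t) =
        g s * g t * (deriv f s * f t - f s * deriv f t)"
      using DERIV_unique unfolding eq by blast
    then show ?thesis
      using t(1) \<open>f t \<noteq> 0\<close> by (simp add: c_def field_simps)
  qed
  have "\<exists>K. \<forall>z\<in>ball t r. g z * exp (- c * z) / f z = K"
  proof (rule has_field_derivative_zero_constant)
    fix z assume "z \<in> ball t r"
    then have "f z \<noteq> 0" by (rule nz)
    have "((\<lambda>z. g z * exp (- c * z) / f z) has_field_derivative
        ((deriv g z * exp (- c * z) + g z * (- c * exp (- c * z))) * f z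
          - g z * exp (- c * z) * deriv f z) / (f z * f z)) (at z)"
      using \<open>f z \<noteq> 0\<close> by (auto intro!: derivative_eq_intros dg df)
    also have "(deriv g z * exp (- c * z) + g z * (- c * exp (- c * z))) * f z
          - g z * exp (- c * z) * deriv f z =
        exp (- c * z) * (deriv g z * f z - g z * deriv f z - c * (g z * f z))"
      by (simp add: algebra_simps)
    also have "\<dots> = 0"
      unfolding ode by simp
    finally show "((\<lambda>z. g z * exp (- c * z) / f z) has_field_derivative 0) (at z within ball t r)"
      by (simp add: has_field_derivative_at_within)
  qed simp
  then obtain K where K: "\<And>z. z \<in> ball t r \<Longrightarrow> g z * exp (- c * z) / f z = K"
    by blast
  have "g z = K * exp (c * z) * f z" for z
  proof (rule analytic_continuation_open[of "ball t r" UNIV g])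
    show "g z = K * exp (c * z) * f z" if "z \<in> ball t r" for z
      using K[OF that] nz[OF that] by (simp add: exp_minus field_simps)
  qed (use t hol holg in \<open>auto intro!: holomorphic_intros\<close>)
  moreover from this[of t] have "K \<noteq> 0" using t(1) by auto
  ultimately show ?thesis
    unfolding g_def by blast
qed

lemma exp_2pi_i_eq_1_imp_int:
  assumes "exp (2 * of_real pi * \<i> * z) = 1"
  obtains n :: int where "z = of_int n"
proof -
  from assms obtain n :: int where "Re (2 * of_real pi * \<i> * z) = 0" "Im (2 * of_real pi * \<i> * z) = of_int (2 * n) * pi"
    unfolding exp_eq_1 by blast
  then have "z = of_int n"
    by (simp add: complex_eq_iff)
  then show thesis by (rule that)
qed

text \<open>
  The multiplier \<open>K exp(cz)\<close> of the translation by \<open>p\<close> must be compatible with the multipliers of the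
  translations by 1 and by \<open>\<tau>\<close>. The former gives \<open>c = 2\<pi>\<i>k\<close>, and the latter then gives
  \<open>exp(2\<pi>\<i>(k\<tau> + p)) = 1\<close>.
\<close>

lemma theta_11_zero_imp_lattice:
  assumes "Im \<tau> > 0" and "theta_char 1 1 p \<tau> = 0"
  obtains m k :: int where "p = of_int m + of_int k * \<tau>"
proof -
  let ?f = "\<lambda>z. theta_char 1 1 z \<tau>"
  obtain a where a: "?f a \<noteq> 0"
    using theta_char_not_identically_zero[OF assms(1)] .
  obtain c K where "K \<noteq> 0" and mult: "\<And>z. ?f (z + p) = K * exp (c * z) * ?f z"
    using weierstrass_zero_imp_quasi_period[OF weierstrass_relation_theta_11[OF assms(1)]
        theta_char_holomorphic[OF assms(1)] a assms(2)]
    by blast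
  have nz: "?f (a + p) \<noteq> 0"
    unfolding mult using a \<open>K \<noteq> 0\<close> by simp
  have "exp c = 1"
  proof -
    have "?f (a + p) * exp c = ?f (a + p)"
      using mult[of "a + 1"] theta_11_add_1[of "a + p" \<tau>] theta_11_add_1[of a \<tau>]
      by (simp add: mult[of a] algebra_simps exp_add)
    with nz show ?thesis by simp
  qed
  then obtain k :: int where k: "c = 2 * of_real pi * \<i> * of_int k"
    using exp_2pi_i_eq_1_imp_int[of "c / (2 * of_real pi * \<i>)"] by (auto simp: field_simps)
  have "exp (c * \<tau>) = exp (- (2 * of_real pi * \<i> * p))"
  proof -
    define M where "M = exp (- of_real pi * \<i> * (\<tau> + 2 * a))"
    have M: "exp (- of_real pi * \<i> * (\<tau> + 2 * (a + p))) = exp (- (2 * of_real pi * \<i> * p)) * M"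
      unfolding M_def exp_add[symmetric] by (rule arg_cong[where f = exp]) (simp add: algebra_simps)
    have "?f (a + p + \<tau>) = - (exp (- (2 * of_real pi * \<i> * p)) * M) * ?f (a + p)"
      unfolding theta_11_add_tau M by simp
    moreover have "?f (a + \<tau> + p) = - (exp (c * \<tau>) * M) * ?f (a + p)"
      unfolding mult theta_11_add_tau M_def by (simp add: exp_add distrib_left)
    ultimately have "exp (- (2 * of_real pi * \<i> * p)) * M = exp (c * \<tau>) * M"
      using nz by (simp add: add_ac)
    then show ?thesis by (simp add: M_def)
  qed
  then have "exp (2 * of_real pi * \<i> * (of_int k * \<tau> + p)) = 1"
    by (simp add: k exp_minus exp_add distrib_left field_simps)
  then obtain n :: int where "of_int k * \<tau> + p = of_int n"
    by (rule exp_2pi_i_eq_1_imp_int)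
  then have "p = of_int n + of_int (- k) * \<tau>"
    by (simp add: algebra_simps)
  then show thesis by (rule that)
qed

section \<open>Logarithmic derivatives at points of order five\<close>

text \<open>
  Put \<open>x = y + t\<close> in the three-term relation and take the derivative at \<open>t = 0\<close>, where the factor
  \<open>f(x - y) = f(t)\<close> vanishes.
\<close>

lemma weierstrass_relation_deriv:
  assumes W: "weierstrass_relation f" and hol: "f holomorphic_on UNIV" and "f 0 = 0"
  shows "deriv f 0 * f (2 * y) * (f (u + v) * f (u - v)) =
    (deriv f (y + u) * f (y - u) + f (y + u) * deriv f (y - u)) * (f (y + v) * f (y - v))
    - (deriv f (y + v) * f (y - v) + f (y + v) * deriv f (y - v)) * (f (y + u) * f (y - u))"
proof -
  have eq: "(\<lambda>t. (f (2 * y + t) * f t) * (f (u + v) * f (u - v))) =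
    (\<lambda>t. (f (y + u + t) * f (y - u + t)) * (f (y + v) * f (y - v))
      - (f (y + v + t) * f (y - v + t)) * (f (y + u) * f (y - u)))"
  proof
    fix t
    have "(f (y + t + y) * f (y + t - y)) * (f (u + v) * f (u - v)) =
      (f (y + t + u) * f (y + t - u)) * (f (y + v) * f (y - v))
      - (f (y + t + v) * f (y + t - v)) * (f (y + u) * f (y - u))"
      using W unfolding weierstrass_relation_def by blast
    then show "(f (2 * y + t) * f t) * (f (u + v) * f (u - v)) =
      (f (y + u + t) * f (y - u + t)) * (f (y + v) * f (y - v))
      - (f (y + v + t) * f (y - v + t)) * (f (y + u) * f (y - u))"
      by (simp add: algebra_simps)
  qed
  have prod: "((\<lambda>t. f (p + t) * f (q + t) * C) has_field_derivative
      (deriv f p * f q + f p * deriv f q) * C) (at 0)" for p q C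
    using DERIV_cmult_right[OF DERIV_mult[OF entire_deriv_translate[OF hol, of p] entire_deriv_translate[OF hol, of q]], of C]
    by (simp add: add.commute mult.commute)
  have "((\<lambda>t. (f (2 * y + t) * f t) * (f (u + v) * f (u - v))) has_field_derivative
      deriv f 0 * f (2 * y) * (f (u + v) * f (u - v))) (at 0)"
    using prod[of "2 * y" 0 "f (u + v) * f (u - v)"] by (simp add: \<open>f 0 = 0\<close> mult.commute)
  from DERIV_unique[OF this[unfolded eq] DERIV_diff[OF prod prod]] show ?thesis .
qed

lemma deriv_odd_entire:
  assumes hol: "f holomorphic_on UNIV" and odd: "\<And>z. f (- z) = - f z"
  shows "deriv f (- w) = deriv f w"
proof -
  have "((\<lambda>z. f (- z)) has_field_derivative deriv f (- w) * (-1)) (at w)"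
    by (rule DERIV_chain2[OF entire_deriv[OF hol]]) (auto intro!: derivative_eq_intros)
  moreover have "((\<lambda>z. f (- z)) has_field_derivative - deriv f w) (at w)"
    unfolding odd by (rule DERIV_minus[OF entire_deriv[OF hol]])
  ultimately show ?thesis
    using DERIV_unique by fastforce
qed

lemma deriv_periodic_entire:
  assumes hol: "f holomorphic_on UNIV" and period: "\<And>z. f (z + p) = \<kappa> * f z"
  shows "deriv f (z + p) = \<kappa> * deriv f z"
proof -
  have "((\<lambda>z. f (z + p)) has_field_derivative deriv f (z + p) * 1) (at z)"
    by (rule DERIV_chain2[OF entire_deriv[OF hol]]) (auto intro!: derivative_eq_intros)
  moreover have "((\<lambda>z. f (z + p)) has_field_derivative \<kappa> * deriv f z) (at z)"
    unfolding period by (rule DERIV_cmult[OF entire_deriv[OF hol]])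
  ultimately show ?thesis
    using DERIV_unique by fastforce
qed

text \<open>
  The arguments \<open>y = 3w/2\<close>, \<open>u = w/2\<close> and \<open>v = 5w/2\<close> in the differentiated relation give logarithmic
  derivatives at \<open>2w\<close>, \<open>w\<close>, \<open>4w\<close> and \<open>-w\<close>. Since \<open>4w = -w + 5w\<close>, the last two reduce to the one at
  \<open>w\<close>, and only \<open>w\<close> and \<open>2w\<close> remain. The sign \<open>\<kappa>\<close> is kept general because \<open>2w\<close> has \<open>\<kappa> = 1\<close>
  whenever \<open>w\<close> has \<open>\<kappa> = -1\<close>.
\<close>

lemma five_torsion_log_deriv:
  assumes W: "weierstrass_relation f" and hol: "f holomorphic_on UNIV"
    and odd: "\<And>z. f (- z) = - f z"
    and period: "\<And>z. f (z + 5 * w) = \<kappa> * f z" and "\<kappa>\<^sup>2 = 1"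
    and nz: "f w \<noteq> 0" "f (2 * w) \<noteq> 0"
  shows "3 * (deriv f w / f w) + deriv f (2 * w) / f (2 * w) =
    - \<kappa> * deriv f 0 * f (2 * w) ^ 2 / f w ^ 3"
proof -
  have "f 0 = 0" using odd[of 0] by simp
  have deriv_minus: "deriv f (- w) = deriv f w"
    by (rule deriv_odd_entire[OF hol odd])
  have deriv_period: "deriv f (z + 5 * w) = \<kappa> * deriv f z" for z
    by (rule deriv_periodic_entire[OF hol period])
  have f3: "f (3 * w) = - \<kappa> * f (2 * w)" and f4: "f (4 * w) = - \<kappa> * f w"
    and d4: "deriv f (4 * w) = \<kappa> * deriv f w"
    using period[of "- 2 * w"] period[of "- w"] deriv_period[of "- w"] odd[of w] odd[of "2 * w"] deriv_minus
    by simp_all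
  let ?y = "3 / 2 * w" and ?u = "1 / 2 * w" and ?v = "5 / 2 * w"
  have pts: "2 * ?y = 3 * w" "?u + ?v = 3 * w" "?u - ?v = - (2 * w)" "?y + ?u = 2 * w" "?y - ?u = w"
    "?y + ?v = 4 * w" "?y - ?v = - w"
    by simp_all
  have "deriv f 0 * f (3 * w) * (f (3 * w) * f (- (2 * w))) =
      (deriv f (2 * w) * f w + f (2 * w) * deriv f w) * (f (4 * w) * f (- w))
      - (deriv f (4 * w) * f (- w) + f (4 * w) * deriv f (- w)) * (f (2 * w) * f w)"
    using weierstrass_relation_deriv[OF W hol \<open>f 0 = 0\<close>, of ?y ?u ?v] unfolding pts .
  then have "- (\<kappa>\<^sup>2 * deriv f 0 * f (2 * w) ^ 3) =
      \<kappa> * (deriv f (2 * w) * f w ^ 3 + 3 * deriv f w * f w ^ 2 * f (2 * w))"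
    unfolding f3 f4 d4 odd deriv_minus by (simp add: power2_eq_square power3_eq_cube algebra_simps)
  then have scaled: "\<kappa> * (- (\<kappa>\<^sup>2 * deriv f 0 * f (2 * w) ^ 3)) =
      \<kappa>\<^sup>2 * (deriv f (2 * w) * f w ^ 3 + 3 * deriv f w * f w ^ 2 * f (2 * w))"
    by (simp only: power2_eq_square mult.assoc)
  have eq: "deriv f (2 * w) * f w ^ 3 + 3 * deriv f w * f w ^ 2 * f (2 * w) =
      - \<kappa> * deriv f 0 * f (2 * w) ^ 2 * f (2 * w)"
  proof -
    have "- \<kappa> * (deriv f 0 * f (2 * w) ^ 3) =
        deriv f (2 * w) * f w ^ 3 + 3 * deriv f w * f w ^ 2 * f (2 * w)"
      using scaled by (simp add: \<open>\<kappa>\<^sup>2 = 1\<close> mult.assoc)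
    then show ?thesis by (simp add: power2_eq_square power3_eq_cube mult.assoc)
  qed
  have "3 * (deriv f w / f w) + deriv f (2 * w) / f (2 * w) =
      (deriv f (2 * w) * f w ^ 3 + 3 * deriv f w * f w ^ 2 * f (2 * w)) / (f w ^ 3 * f (2 * w))"
    using nz by (simp add: divide_simps power2_eq_square power3_eq_cube; simp add: algebra_simps)
  also have "\<dots> = - \<kappa> * deriv f 0 * f (2 * w) ^ 2 / f w ^ 3"
    unfolding eq using nz by simp
  finally show ?thesis .
qed

section \<open>The theta function normalised along the period \<open>1 - \<tau>\<close>\<close>

text \<open>
  The Gaussian is the one that turns the quasi-period \<open>1 - \<tau>\<close> of \<open>\<theta>[1,1]\<close> into an honest
  antiperiod.
\<close>

definition norm_theta :: "complex \<Rightarrow> complex \<Rightarrow> complex" where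
  "norm_theta \<tau> z = exp (- of_real pi * \<i> / (1 - \<tau>) * z\<^sup>2) * theta_char 1 1 z \<tau>"

lemma norm_theta_period:
  assumes "Im \<tau> > 0"
  shows "norm_theta \<tau> (z + (1 - \<tau>)) = - norm_theta \<tau> z"
proof -
  have "1 - \<tau> \<noteq> 0" using assms by auto
  define E where "E = exp (of_real pi * \<i> * (2 * z - \<tau>))"
  have "theta_char 1 1 z \<tau> * E = - theta_char 1 1 (z - \<tau>) \<tau>"
    using theta_11_add_tau[of "z - \<tau>" \<tau>] unfolding E_def
    by (simp add: exp_minus[symmetric] exp_add[symmetric] algebra_simps)
  then have shift: "theta_char 1 1 (z + (1 - \<tau>)) \<tau> = E * theta_char 1 1 z \<tau>"
    using theta_11_add_1[of "z - \<tau>" \<tau>] by (simp add: algebra_simps)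
  have "norm_theta \<tau> (z + (1 - \<tau>)) =
      (exp (- of_real pi * \<i> / (1 - \<tau>) * (z + (1 - \<tau>))\<^sup>2) * E) * theta_char 1 1 z \<tau>"
    by (simp only: norm_theta_def shift mult.assoc)
  also have "exp (- of_real pi * \<i> / (1 - \<tau>) * (z + (1 - \<tau>))\<^sup>2) * E =
      exp (- of_real pi * \<i> / (1 - \<tau>) * z\<^sup>2) * exp (- (of_real pi * \<i>))"
    unfolding E_def exp_add[symmetric] using \<open>1 - \<tau> \<noteq> 0\<close>
    by (intro arg_cong[where f = exp]) (simp add: power2_eq_square divide_simps; simp add: algebra_simps)
  also have "exp (- (of_real pi * \<i>)) = -1"
    by (simp add: exp_minus)
  finally show ?thesis
    by (simp add: norm_theta_def)
qed

text \<open>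
  The shift of the characteristic \<open>[1,1]\<close> by \<open>[-2s, 2s]\<close> translates the argument by
  \<open>s(1 - \<tau>)\<close>. The part of its exponential factor that is linear in \<open>\<zeta>\<close> is absorbed by the Gaussian in \<open>norm_theta\<close>; a factor quadratic in \<open>\<zeta>\<close>
  remains, which affects neither the value nor the first derivative at \<open>\<zeta> = 0\<close>.
\<close>

lemma theta_char_eq_norm_theta:
  fixes s :: real
  assumes "Im \<tau> > 0"
  shows "theta_char (1 - 2 * s) (1 + 2 * s) \<zeta> \<tau> =
    exp (- of_real pi * \<i> * of_real (s + s\<^sup>2)) *
    (exp (of_real pi * \<i> / (1 - \<tau>) * \<zeta>\<^sup>2) * norm_theta \<tau> (\<zeta> + of_real s * (1 - \<tau>)))"
proof -
  have "1 - \<tau> \<noteq> 0" using assms by auto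
  have "exp (2 * of_real pi * \<i> * (1 / 2 * of_real (- s) ^ 2 * \<tau> + of_real (- s) * (\<zeta> + of_real 1 / 2 + of_real s))) =
    exp (- of_real pi * \<i> * of_real (s + s\<^sup>2)) *
    (exp (of_real pi * \<i> / (1 - \<tau>) * \<zeta>\<^sup>2) * exp (- of_real pi * \<i> / (1 - \<tau>) * (\<zeta> + of_real s * (1 - \<tau>))\<^sup>2))"
    unfolding exp_add[symmetric] using \<open>1 - \<tau> \<noteq> 0\<close>
    by (intro arg_cong[where f = exp]) (simp add: power2_eq_square divide_simps; simp add: algebra_simps)
  moreover have "\<zeta> + of_real (- s) * \<tau> + of_real s = \<zeta> + of_real s * (1 - \<tau>)"
    by (simp add: algebra_simps)
  moreover have "theta_char (1 - 2 * s) (1 + 2 * s) \<zeta> \<tau> =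
    exp (2 * of_real pi * \<i> * (1 / 2 * of_real (- s) ^ 2 * \<tau> + of_real (- s) * (\<zeta> + of_real 1 / 2 + of_real s)))
    * theta_char 1 1 (\<zeta> + of_real (- s) * \<tau> + of_real s) \<tau>"
    using theta_char_characteristic_shift[of 1 "- s" 1 s \<zeta> \<tau>] by simp
  ultimately show ?thesis
    by (simp only: norm_theta_def mult.assoc)
qed

lemma norm_theta_holomorphic:
  assumes "Im \<tau> > 0"
  shows "norm_theta \<tau> holomorphic_on UNIV"
proof -
  have "1 - \<tau> \<noteq> 0" using assms by auto
  then have "(\<lambda>z. exp (- of_real pi * \<i> / (1 - \<tau>) * z\<^sup>2) * theta_char 1 1 z \<tau>) holomorphic_on UNIV"
    by (intro holomorphic_intros theta_char_holomorphic assms)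
  then show ?thesis
    by (simp add: norm_theta_def[abs_def])
qed

lemma theta_const_eq_norm_theta:
  fixes s :: real
  assumes "Im \<tau> > 0"
  shows "theta_const (1 - 2 * s) (1 + 2 * s) \<tau> =
    exp (- of_real pi * \<i> * of_real (s + s\<^sup>2)) * norm_theta \<tau> (of_real s * (1 - \<tau>))"
  unfolding theta_const_def theta_char_eq_norm_theta[OF assms] by simp

lemma theta_deriv_eq_norm_theta:
  fixes s :: real
  assumes "Im \<tau> > 0"
  shows "theta_deriv (1 - 2 * s) (1 + 2 * s) \<tau> =
    exp (- of_real pi * \<i> * of_real (s + s\<^sup>2)) * deriv (norm_theta \<tau>) (of_real s * (1 - \<tau>))"
proof -
  define C where "C = exp (- of_real pi * \<i> * of_real (s + s\<^sup>2))"
  have "1 - \<tau> \<noteq> 0" using assms by auto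
  then have "((\<lambda>\<zeta>. C * (exp (of_real pi * \<i> / (1 - \<tau>) * \<zeta>\<^sup>2) * norm_theta \<tau> (\<zeta> + of_real s * (1 - \<tau>))))
    has_field_derivative C * deriv (norm_theta \<tau>) (of_real s * (1 - \<tau>))) (at 0)"
    by - (rule derivative_eq_intros DERIV_chain2[OF entire_deriv[OF norm_theta_holomorphic[OF assms]]] refl | simp)+
  then show ?thesis
    unfolding theta_deriv_def theta_char_eq_norm_theta[OF assms] C_def[symmetric]
    by (rule DERIV_imp_deriv)
qed

text \<open>
  A point \<open>s(1 - \<tau>)\<close> of the lattice \<open>\<int> + \<int>\<tau>\<close> has integral \<open>\<tau>\<close>-coordinate \<open>-s\<close>.
\<close>

lemma norm_theta_nonzero:
  fixes s :: real
  assumes "Im \<tau> > 0" and "s \<notin> \<int>"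
  shows "norm_theta \<tau> (of_real s * (1 - \<tau>)) \<noteq> 0"
proof
  assume "norm_theta \<tau> (of_real s * (1 - \<tau>)) = 0"
  then obtain m k :: int where "of_real s * (1 - \<tau>) = of_int m + of_int k * \<tau>"
    using theta_11_zero_imp_lattice[OF assms(1)] by (auto simp: norm_theta_def)
  then have "Im (of_real s * (1 - \<tau>)) = Im (of_int m + of_int k * \<tau>)"
    by simp
  then have "- s * Im \<tau> = of_int k * Im \<tau>"
    by simp
  then have "- s = of_int k"
    using assms(1) by (metis less_irrefl mult_right_cancel)
  then have "s = of_int (- k)"
    by simp
  then show False
    using assms(2) Ints_of_int by blast
qed

section \<open>The two logarithmic derivatives\<close>

theorem theorem4p6:
  fixes \<tau> :: complex
  assumes "Im \<tau> > 0"
  shows "theta_deriv (1/5) (9/5) \<tau> / theta_const (1/5) (9/5) \<tau>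
       = root_unity 5 * theta_deriv 1 1 \<tau>
         * ((theta_const (1/5) (9/5) \<tau> ^ 5 - 3 * root_unity 5 * theta_const (3/5) (7/5) \<tau> ^ 5)
            / (10 * theta_const (1/5) (9/5) \<tau> ^ 3 * theta_const (3/5) (7/5) \<tau> ^ 3))
     \<and> theta_deriv (3/5) (7/5) \<tau> / theta_const (3/5) (7/5) \<tau>
       = root_unity 5 * theta_deriv 1 1 \<tau>
         * ((3 * theta_const (1/5) (9/5) \<tau> ^ 5 + root_unity 5 * theta_const (3/5) (7/5) \<tau> ^ 5)
            / (10 * theta_const (1/5) (9/5) \<tau> ^ 3 * theta_const (3/5) (7/5) \<tau> ^ 3))"
proof -
  define w where "w = (1 - \<tau>) / 5"
  define f where "f = norm_theta \<tau>"
  \<comment> \<open>The constants \<open>exp (- \<pi>\<i> (s + s\<^sup>2))\<close> for \<open>s = 2/5\<close> and \<open>s = 1/5\<close>.\<close>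
  define a b where "a = exp (- of_real pi * \<i> * (14 / 25))" and "b = exp (- of_real pi * \<i> * (6 / 25))"
  define z where "z = root_unity 5"
  have W: "weierstrass_relation f"
    unfolding f_def norm_theta_def[abs_def]
    by (rule weierstrass_relation_gaussian[OF weierstrass_relation_theta_11[OF assms]])
  have hol: "f holomorphic_on UNIV"
    unfolding f_def by (rule norm_theta_holomorphic[OF assms])
  have odd: "f (- x) = - f x" for x
    by (simp add: f_def norm_theta_def theta_11_minus)
  have period: "f (x + 5 * w) = - f x" for x
  proof -
    have "5 * w = 1 - \<tau>" by (simp add: w_def)
    then show ?thesis
      using norm_theta_period[OF assms] by (simp only: f_def)
  qed
  have f1: "f w \<noteq> 0" and f2: "f (2 * w) \<noteq> 0"
  proof -
    have "1 / 5 \<notin> (\<int> :: real set)" "2 / 5 \<notin> (\<int> :: real set)"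
      by (auto elim!: Ints_cases simp: field_simps)
    then show "f w \<noteq> 0" "f (2 * w) \<noteq> 0"
      using norm_theta_nonzero[OF assms, of "1 / 5"] norm_theta_nonzero[OF assms, of "2 / 5"]
      by (simp_all add: f_def w_def)
  qed
  \<comment> \<open>The formula at \<open>2 * w\<close> involves the point \<open>4 * w\<close>, which is \<open>- w\<close> moved by the antiperiod \<open>5 * w\<close>.\<close>
  have f4: "f (4 * w) = f w" and d4: "deriv f (4 * w) = - deriv f w"
    using period[of "- w"] odd[of w] deriv_periodic_entire[OF hol, of "5 * w" "-1" "- w"] period
      deriv_odd_entire[OF hol odd, of w]
    by simp_all
  have P: "3 * (deriv f w / f w) + deriv f (2 * w) / f (2 * w) = deriv f 0 * f (2 * w) ^ 2 / f w ^ 3"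
    using five_torsion_log_deriv[OF W hol odd, of w "-1"] period f1 f2 by simp
  have Q: "3 * (deriv f (2 * w) / f (2 * w)) - deriv f w / f w = - deriv f 0 * f w ^ 2 / f (2 * w) ^ 3"
  proof -
    have "f (x + 5 * (2 * w)) = 1 * f x" for x
      using period[of x] period[of "x + 5 * w"] by (simp add: algebra_simps)
    then show ?thesis
      using five_torsion_log_deriv[OF W hol odd, of "2 * w" 1] f1 f2 f4 d4 by simp
  qed
  have vals: "theta_const (1/5) (9/5) \<tau> = a * f (2 * w)" "theta_const (3/5) (7/5) \<tau> = b * f w"
    using theta_const_eq_norm_theta[OF assms, of "2 / 5"] theta_const_eq_norm_theta[OF assms, of "1 / 5"]
    by (simp_all add: a_def b_def f_def w_def power2_eq_square)
  have derivs: "theta_deriv (1/5) (9/5) \<tau> = a * deriv f (2 * w)" "theta_deriv (3/5) (7/5) \<tau> = b * deriv f w"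
    "theta_deriv 1 1 \<tau> = deriv f 0"
    using theta_deriv_eq_norm_theta[OF assms, of "2 / 5"] theta_deriv_eq_norm_theta[OF assms, of "1 / 5"]
      theta_deriv_eq_norm_theta[OF assms, of 0]
    by (simp_all add: a_def b_def f_def w_def power2_eq_square)
  have z: "z = exp (2 * of_real pi * \<i> / 5)"
    by (simp add: z_def root_unity_def)
  have ab1: "z * b ^ 5 = a ^ 5"
  proof -
    have "z * b ^ 5 = a ^ 5 * exp (2 * of_real pi * \<i> * of_int 1)"
      unfolding z a_def b_def exp_of_nat_mult[symmetric] exp_add[symmetric]
      by (rule arg_cong[where f = exp]) (simp add: field_simps)
    then show ?thesis unfolding exp_2pi_i_int by simp
  qed
  have ab2: "z * a ^ 5 = a ^ 3 * b ^ 3"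
    unfolding z a_def b_def exp_of_nat_mult[symmetric] exp_add[symmetric]
    by (rule arg_cong[where f = exp]) (simp add: field_simps)
  have ab: "a \<noteq> 0" "b \<noteq> 0" by (simp_all add: a_def b_def)
  \<comment> \<open>By the two relations between \<open>a\<close>, \<open>b\<close> and \<open>z\<close>, all roots of unity cancel from the right-hand sides.\<close>
  have pref: "z * deriv f 0 * ((m * (a * f (2 * w)) ^ 5 + n * (z * (b * f w) ^ 5))
        / (10 * (a * f (2 * w)) ^ 3 * (b * f w) ^ 3)) =
      deriv f 0 * (m * f (2 * w) ^ 5 + n * f w ^ 5) / (10 * f (2 * w) ^ 3 * f w ^ 3)" for m n
  proof -
    have "m * (a * f (2 * w)) ^ 5 + n * (z * (b * f w) ^ 5) =
        m * a ^ 5 * f (2 * w) ^ 5 + n * (z * b ^ 5) * f w ^ 5"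
      by (simp add: power_mult_distrib)
    also have "\<dots> = a ^ 5 * (m * f (2 * w) ^ 5 + n * f w ^ 5)"
      unfolding ab1 by (simp add: algebra_simps)
    finally have "z * deriv f 0 * ((m * (a * f (2 * w)) ^ 5 + n * (z * (b * f w) ^ 5))
        / (10 * (a * f (2 * w)) ^ 3 * (b * f w) ^ 3)) =
      (z * a ^ 5) * (deriv f 0 * (m * f (2 * w) ^ 5 + n * f w ^ 5)) /
      ((a ^ 3 * b ^ 3) * (10 * f (2 * w) ^ 3 * f w ^ 3))"
      by (simp add: power_mult_distrib mult_ac)
    then show ?thesis
      unfolding ab2 using ab by simp
  qed
  \<comment> \<open>Cramer's rule for the linear system \<open>P\<close>, \<open>Q\<close>.\<close>
  have "deriv f (2 * w) / f (2 * w) = ((3 * (deriv f w / f w) + deriv f (2 * w) / f (2 * w))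
      + 3 * (3 * (deriv f (2 * w) / f (2 * w)) - deriv f w / f w)) / 10"
    by simp
  also have "\<dots> = deriv f 0 * (1 * f (2 * w) ^ 5 + (-3) * f w ^ 5) / (10 * f (2 * w) ^ 3 * f w ^ 3)"
    unfolding P Q using f1 f2 by (simp add: field_simps)
  finally have 2: "deriv f (2 * w) / f (2 * w) = \<dots>" .
  have "deriv f w / f w = (3 * (3 * (deriv f w / f w) + deriv f (2 * w) / f (2 * w))
      - (3 * (deriv f (2 * w) / f (2 * w)) - deriv f w / f w)) / 10"
    by simp
  also have "\<dots> = deriv f 0 * (3 * f (2 * w) ^ 5 + 1 * f w ^ 5) / (10 * f (2 * w) ^ 3 * f w ^ 3)"
    unfolding P Q using f1 f2 by (simp add: field_simps)
  finally have 1: "deriv f w / f w = \<dots>" .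
  show ?thesis
    unfolding vals derivs z_def[symmetric]
    using 1[folded pref] 2[folded pref] ab by simp
qed

end
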